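(* Let $q$ be a prime power, $n$ a positive integer, and let $W$ be a multiset over $\mathbb{F}_q^n$. Then $W$ is a multispace over $\mathbb{F}_q^n$ if and only if the following two conditions hold: (i) the underlying set $\underline{W}$ is a subspace of $\mathbb{F}_q^n$; (ii) there is a nonnegative integer $t$ such that every element of $W$ (i.e., every $v\in\underline{W}$) has multiplicity $q^t$ in $W$. Furthermore, in that case, $t = \operatorname{rank}(W) - \dim(W)$.
   Context: A multiset $M$ over a universe $U$ is given by a multiplicity function $\mu_M\colon U\to\{0,1,2,\ldots\}$; its underlying set is $\underline{M}=\{a\in U:\mu_M(a)>0\}$ and its size is $|M|=\sum_{a\in U}\mu_M(a)$. Let $B=\{\!\{b_1,\ldots,b_m\}\!\}$ be a finite multiset over $\mathbb{F}_q^n$ (the $b_i$ are not necessarily distinct). The multispan $\operatorname{mspan}_q(B)$ is the multiset over $\mathbb{F}_q^n$ in which the multiplicity of $v$ is the number of $m$-tuples $(\alpha_1,\ldots,\alpha_m)\in\mathbb{F}_q^m$ with $\sum_{i=1}^m\alpha_i b_i=v$; if $B$ is empty, $\operatorname{mspan}_q(B)=\{0\}$ (with $0$ of multiplicity $1$). Thus $|\operatorname{mspan}_q(B)|=q^{|B|}$. A multiset $W$ over $\mathbb{F}_q^n$ is a multispace over $\mathbb{F}_q^n$ if $W=\operatorname{mspan}_q(B)$ for some multiset $B$; then $\operatorname{rank}(W)=|B|=\log_q|W|$ and $\dim(W)=\dim(\operatorname{span}_q(B))$, where $\operatorname{span}_q$ is the ordinary $\mathbb{F}_q$-linear span. *)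

theory Defs
  imports "HOL-Analysis.Cartesian_Space" "HOL-Combinatorics.List_Permutation"
begin

text \<open>
  The field with \<open>q\<close> elements is rendered as an arbitrary type \<open>'q\<close> of classes \<open>field\<close> and \<open>finite\<close>, with
  \<open>q = CARD('q)\<close>; the orders of such types are exactly the orders of finite fields, i.e. prime powers.
  As \<open>'q ^ 'n\<close> is finite, its (finite) library multisets correspond to all multiplicity functions \<open>'q ^ 'n \<Rightarrow> nat\<close>.
\<close>

definition lincomb :: "'q list \<Rightarrow> ('q::field ^ 'n) list \<Rightarrow> 'q ^ 'n" where
  "lincomb as bs = (\<Sum>i<length bs. as ! i *s bs ! i)"

definition mspan_list :: "('q::{field,finite} ^ 'n::finite) list \<Rightarrow> ('q ^ 'n) multiset" where
  "mspan_list bs =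
     Abs_multiset (\<lambda>v. card {as. length as = length bs \<and> lincomb as bs = v})"

text \<open>
  The choice of the enumeration of \<open>B\<close> is immaterial, see \<open>mspan_mset\<close> below.
\<close>

definition mspan :: "('q::{field,finite} ^ 'n::finite) multiset \<Rightarrow> ('q ^ 'n) multiset" where
  "mspan B = mspan_list (SOME bs. mset bs = B)"

definition multispace :: "('q::{field,finite} ^ 'n::finite) multiset \<Rightarrow> bool" where
  "multispace W \<longleftrightarrow> (\<exists>B. W = mspan B)"

text \<open>
  Rank and dimension do not depend on the generating multiset, see \<open>mrank_mspan\<close> and
  \<open>mdim_mspan\<close> below; both are unspecified if \<open>W\<close> is not a multispace.
\<close>

definition mrank :: "('q::{field,finite} ^ 'n::finite) multiset \<Rightarrow> nat" where
  "mrank W = (THE r. \<exists>B. W = mspan B \<and> r = size B)"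

definition mdim :: "('q::{field,finite} ^ 'n::finite) multiset \<Rightarrow> nat" where
  "mdim W = (THE d. \<exists>B. W = mspan B \<and> d = vec.dim (vec.span (set_mset B)))"

lemma finite_tuples: "finite {as :: 'q::finite list. length as = m \<and> P as}"
  by (rule finite_subset[OF _ finite_lists_length_eq[of UNIV m]]) auto

lemma count_mspan_list:
  "count (mspan_list bs) v = card {as. length as = length bs \<and> lincomb as bs = v}"
  unfolding mspan_list_def by (subst Abs_multiset_inverse) auto

lemma count_mspan_list_mono:
  fixes bs cs :: "('q::{field,finite} ^ 'n::finite) list"
  assumes "mset bs = mset cs"
  shows "count (mspan_list cs) v \<le> count (mspan_list bs) v"
proof -
  obtain p where p: "p permutes {..<length cs}" "permute_list p cs = bs"
    using mset_eq_permutation[OF assms] by blast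
  have len: "length bs = length cs" using assms by (rule mset_eq_length)
  have comb: "lincomb (permute_list p as) bs = lincomb as cs" if "length as = length cs" for as
  proof -
    have "lincomb (permute_list p as) bs = (\<Sum>i<length cs. as ! p i *s cs ! p i)"
      unfolding lincomb_def len
      by (intro sum.cong) (use p that in \<open>auto simp: permute_list_nth\<close>)
    also have "\<dots> = lincomb as cs"
      unfolding lincomb_def using sum.permute[OF p(1), of "\<lambda>i. as ! i *s cs ! i"]
      by (simp add: o_def)
    finally show ?thesis .
  qed
  show ?thesis unfolding count_mspan_list
  proof (rule card_inj_on_le[of "permute_list p"])
    show "inj_on (permute_list p) {as. length as = length cs \<and> lincomb as cs = v}"
    proof (rule inj_onI, clarsimp)
      fix as as' :: "'q list"
      assume l: "length as = length cs" "length as' = length cs"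
        and eq: "permute_list p as = permute_list p as'"
      show "as = as'"
      proof (rule nth_equalityI)
        fix i assume "i < length as"
        then obtain j where "j < length cs" "i = p j"
          using p(1) l by (metis lessThan_iff permutes_surj permutes_in_image surjD)
        then show "as ! i = as' ! i"
          using eq l p(1) by (metis permute_list_nth)
      qed (use l in simp)
    qed
  qed (use comb len in \<open>auto intro: finite_tuples\<close>)
qed

lemma mspan_list_cong: "mset bs = mset cs \<Longrightarrow> mspan_list bs = mspan_list cs"
  by (intro multiset_eqI antisym count_mspan_list_mono) simp_all

lemma mspan_mset: "mspan (mset bs) = mspan_list bs"
  unfolding mspan_def by (rule mspan_list_cong, rule someI) (rule refl)

lemma count_mspan:
  "count (mspan (mset bs)) v = card {as. length as = length bs \<and> lincomb as bs = v}"
  by (simp add: mspan_mset count_mspan_list)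

lemma mspan_empty: "mspan {#} = {#0#}"
proof (rule multiset_eqI)
  fix v :: "'a ^ 'b"
  have "{as :: 'a list. length as = length [] \<and> lincomb as [] = v} = (if v = 0 then {[]} else {})"
    by (auto simp: lincomb_def)
  then show "count (mspan {#}) v = count {#0#} v"
    using count_mspan[of "[] :: ('a ^ 'b) list" v] by (simp split: if_splits)
qed

lemma size_mspan:
  fixes B :: "('q::{field,finite} ^ 'n::finite) multiset"
  shows "size (mspan B) = CARD('q) ^ size B"
proof -
  obtain bs where B: "B = mset bs" using ex_mset by metis
  have "size (mspan B) = (\<Sum>v\<in>UNIV. count (mspan B) v)"
    unfolding size_multiset_overloaded_eq
    by (rule sum.mono_neutral_left) (auto simp: not_in_iff)
  also have "\<dots> = card (\<Union>v\<in>UNIV. {as :: 'q list. length as = length bs \<and> lincomb as bs = v})"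
    unfolding B count_mspan
    by (rule card_UN_disjoint[symmetric]) (auto intro: finite_tuples)
  also have "(\<Union>v\<in>UNIV. {as :: 'q list. length as = length bs \<and> lincomb as bs = v})
      = {as. set as \<subseteq> UNIV \<and> length as = length bs}"
    by auto
  also have "card \<dots> = CARD('q) ^ size B"
    by (subst card_lists_length_eq) (auto simp: B)
  finally show ?thesis .
qed

lemma set_mset_mspan: "set_mset (mspan B) = vec.span (set_mset B)"
proof -
  obtain bs where B: "B = mset bs" using ex_mset by metis
  let ?S = "{lincomb as bs |as. length as = length bs}"
  have mem: "v \<in># mspan B \<longleftrightarrow> v \<in> ?S" for v
  proof -
    have "v \<in># mspan B \<longleftrightarrow> {as. length as = length bs \<and> lincomb as bs = v} \<noteq> {}"
      unfolding count_greater_zero_iff[symmetric] B count_mspan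
      by (simp add: card_gt_0_iff finite_tuples)
    then show ?thesis by auto
  qed
  have sub: "vec.subspace ?S"
  proof (rule vec.subspaceI)
    show "0 \<in> ?S"
      by (rule CollectI, rule exI[of _ "replicate (length bs) 0"]) (auto simp: lincomb_def)
  next
    fix x y assume "x \<in> ?S" "y \<in> ?S"
    then obtain as cs where *: "length as = length bs" "x = lincomb as bs"
      "length cs = length bs" "y = lincomb cs bs" by auto
    then have "x + y = lincomb (map2 (+) as cs) bs"
      by (simp add: lincomb_def sum.distrib[symmetric] vector_sadd_rdistrib)
    with * show "x + y \<in> ?S" by (intro CollectI exI[of _ "map2 (+) as cs"]) simp
  next
    fix c x assume "x \<in> ?S"
    then obtain as where *: "length as = length bs" "x = lincomb as bs" by auto
    then have "c *s x = lincomb (map ((*) c) as) bs"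
      by (simp add: lincomb_def vec.scale_sum_right vector_smult_assoc)
    with * show "c *s x \<in> ?S" by (intro CollectI exI[of _ "map ((*) c) as"]) simp
  qed
  have gen: "set bs \<subseteq> ?S"
  proof
    fix b assume "b \<in> set bs"
    then obtain k where k: "k < length bs" "b = bs ! k" by (metis in_set_conv_nth)
    let ?as = "map (\<lambda>i. if i = k then 1 else 0) [0..<length bs]"
    have "lincomb ?as bs = (\<Sum>i<length bs. if i = k then bs ! i else 0)"
      unfolding lincomb_def by (rule sum.cong) auto
    also have "\<dots> = b" using k by simp
    finally show "b \<in> ?S" by (intro CollectI exI[of _ ?as]) simp
  qed
  have "lincomb as bs \<in> vec.span (set bs)" for as
    unfolding lincomb_def by (intro vec.span_sum vec.span_scale vec.span_base) auto
  then have "?S \<subseteq> vec.span (set bs)" by auto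
  moreover have "vec.span (set bs) \<subseteq> ?S" by (rule vec.span_minimal[OF gen sub])
  ultimately show ?thesis using mem B by auto
qed

lemma mrank_mspan: "mrank (mspan B) = size B"
  for B :: "('q::{field,finite} ^ 'n::finite) multiset"
proof -
  have "CARD('q) > 1"
    using card_mono[of "UNIV :: 'q set" "{0, 1}"] by simp
  then have "size C = size B" if "mspan B = mspan C" for C :: "('q ^ 'n) multiset"
    using size_mspan[of B] size_mspan[of C] that by simp
  then show ?thesis unfolding mrank_def by blast
qed

lemma mdim_mspan: "mdim (mspan B) = vec.dim (vec.span (set_mset B))"
  for B :: "('q::{field,finite} ^ 'n::finite) multiset"
  unfolding mdim_def by (rule the_equality) (metis set_mset_mspan)+

end

theory Submission
  imports Defs
begin

text \<open>
  The coefficient tuples representing a vector \<open>v\<close> of the span form a translate of those representing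
  \<open>0\<close>, so all multiplicities in a multispace agree; comparing sizes, they equal
  \<open>q\<close> to the power \<open>rank - dim\<close>. Conversely, a basis of the underlying subspace together with
  \<open>t\<close> copies of \<open>0\<close> generates \<open>W\<close>.
\<close>

text \<open>With base above 1, equal powers have equal exponents and comparison of powers gives
  comparison of exponents.\<close>

lemma one_less_CARD_field: "1 < CARD('q::{field,finite})"
  using card_mono[of "UNIV :: 'q set" "{0, 1}"] by simp

lemma lincomb_map2_add:
  "length as = length bs \<Longrightarrow> length cs = length bs \<Longrightarrow>
    lincomb (map2 (+) as cs) bs = lincomb as bs + lincomb cs bs"
  by (simp add: lincomb_def sum.distrib[symmetric] vector_sadd_rdistrib)

text \<open>Fix one coefficient tuple \<open>cs\<close> representing \<open>v\<close>. Adding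
  \<open>cs\<close> entrywise sends tuples for \<open>u\<close> injectively to tuples for
  \<open>v + u\<close>.\<close>

lemma count_mspan_add_le:
  fixes B :: "('q::{field,finite} ^ 'n::finite) multiset"
  assumes "v \<in># mspan B"
  shows "count (mspan B) u \<le> count (mspan B) (v + u)"
proof -
  obtain bs where B: "B = mset bs" using ex_mset by metis
  have "card {as. length as = length bs \<and> lincomb as bs = v} \<noteq> 0"
    using assms by (simp add: B count_mspan[symmetric])
  then obtain cs where cs: "length cs = length bs" "lincomb cs bs = v"
    by (metis (mono_tags, lifting) card.empty empty_Collect_eq)
  show ?thesis unfolding B count_mspan
  proof (rule card_inj_on_le[of "map2 (+) cs"])
    show "inj_on (map2 (+) cs) {as. length as = length bs \<and> lincomb as bs = u}"
    proof (rule inj_onI, clarsimp)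
      fix as as' :: "'q list"
      assume l: "length as = length bs" "length as' = length bs"
        and eq: "map2 (+) cs as = map2 (+) cs as'"
      show "as = as'"
      proof (rule nth_equalityI)
        fix i assume "i < length as"
        then show "as ! i = as' ! i"
          using arg_cong[OF eq, of "\<lambda>xs. xs ! i"] l cs(1) by simp
      qed (use l in simp)
    qed
  qed (use cs in \<open>auto intro: finite_tuples simp: lincomb_map2_add\<close>)
qed

lemma count_mspan_const:
  fixes B :: "('q::{field,finite} ^ 'n::finite) multiset"
  assumes "v \<in># mspan B"
  shows "count (mspan B) v = count (mspan B) 0"
proof (rule antisym)
  \<comment> \<open>The underlying set is a span, hence closed under negation; translating by
    \<open>- v\<close> and by \<open>v\<close> then gives the two inequalities.\<close>
  have "- v \<in># mspan B"
    using assms by (simp add: set_mset_mspan vec.span_neg)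
  from count_mspan_add_le[OF this, of v]
  show "count (mspan B) v \<le> count (mspan B) 0" by simp
  from count_mspan_add_le[OF assms, of 0]
  show "count (mspan B) 0 \<le> count (mspan B) v" by simp
qed

text \<open>Each new independent vector \<open>b\<close> multiplies the size by q: the map (k, x) to
  \<open>k *s b + x\<close> is a bijection from pairs of a scalar and an element of the old span
  onto the new span.\<close>

lemma card_span_independent:
  fixes S :: "('q::{field,finite} ^ 'n::finite) set"
  assumes "vec.independent S"
  shows "card (vec.span S) = CARD('q) ^ card S"
  using finite[of S] assms
proof (induction S)
  case empty
  then show ?case by simp
next
  case (insert b S)
  then have ind: "vec.independent S" and b: "b \<notin> vec.span S"
    by (auto simp: vec.independent_insert)
  let ?f = "\<lambda>(k :: 'q, x). k *s b + x"
  have img: "vec.span (insert b S) = ?f ` (UNIV \<times> vec.span S)"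
  proof (intro equalityI subsetI)
    fix x assume "x \<in> vec.span (insert b S)"
    then obtain k where "x - k *s b \<in> vec.span S"
      unfolding vec.span_insert by blast
    then show "x \<in> ?f ` (UNIV \<times> vec.span S)"
      by (intro image_eqI[of _ _ "(k, x - k *s b)"]) auto
  next
    fix x assume "x \<in> ?f ` (UNIV \<times> vec.span S)"
    then show "x \<in> vec.span (insert b S)"
      by (auto intro!: vec.span_add vec.span_scale intro: vec.span_base
          vec.span_mono[of S, THEN subsetD])
  qed
  have inj: "inj_on ?f (UNIV \<times> vec.span S)"
  proof (rule inj_onI, clarsimp)
    fix k l :: 'q and x y
    assume x: "x \<in> vec.span S" and y: "y \<in> vec.span S" and eq: "k *s b + x = l *s b + y"
    have "(k - l) *s b = y - x"
      using eq by (simp add: vec.scale_left_diff_distrib algebra_simps)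
    then have "(k - l) *s b \<in> vec.span S"
      using x y by (simp add: vec.span_diff)
    \<comment> \<open>Otherwise scaling by \<open>inverse (k - l)\<close> would put \<open>b\<close>
      itself into \<open>vec.span S\<close>.\<close>
    then have "k = l"
      using b vec.span_scale[of "(k - l) *s b" S "inverse (k - l)"]
      by (cases "k = l") (simp_all add: vector_smult_assoc)
    with eq show "k = l \<and> x = y" by simp
  qed
  have "card (vec.span (insert b S)) = CARD('q) * card (vec.span S)"
    unfolding img by (simp add: card_image[OF inj] card_cartesian_product)
  then show ?case using insert ind by simp
qed

lemma card_subspace:
  fixes V :: "('q::{field,finite} ^ 'n::finite) set"
  assumes "vec.subspace V"
  shows "card V = CARD('q) ^ vec.dim V"
proof -
  obtain S where S: "S \<subseteq> V" "vec.independent S" "V \<subseteq> vec.span S" "card S = vec.dim V"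
    using vec.basis_exists by blast
  then have "vec.span S = V"
    using assms by (simp add: vec.span_subspace)
  with S card_span_independent[of S] show ?thesis by simp
qed

text \<open>Count the multispan twice: there are q^|B| coefficient tuples, and the q^d vectors of
  the span all share the multiplicity of 0. The bound on \<open>d\<close> ensures that the
  natural-number difference in the exponent is not truncated.\<close>

lemma count_mspan_eq:
  fixes B :: "('q::{field,finite} ^ 'n::finite) multiset"
  defines "d \<equiv> vec.dim (vec.span (set_mset B))"
  shows "d \<le> size B"
    and "v \<in># mspan B \<Longrightarrow> count (mspan B) v = CARD('q) ^ (size B - d)"
proof -
  let ?c = "count (mspan B) 0"
  have "size (mspan B) = (\<Sum>v\<in>set_mset (mspan B). ?c)"
    unfolding size_multiset_overloaded_eq by (rule sum.cong) (simp_all add: count_mspan_const)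
  then have sz: "CARD('q) ^ size B = CARD('q) ^ d * ?c"
    by (simp add: size_mspan set_mset_mspan card_subspace vec.subspace_span d_def)
  have "0 \<in># mspan B" by (simp add: set_mset_mspan vec.span_zero)
  then have "?c > 0" by simp
  with sz have "CARD('q) ^ d \<le> CARD('q) ^ size B" by simp
  then show le: "d \<le> size B"
    using one_less_CARD_field[where 'q = 'q] by simp
  have "CARD('q) ^ size B = CARD('q) ^ d * CARD('q) ^ (size B - d)"
    using le by (simp add: power_add[symmetric])
  with sz have "?c = CARD('q) ^ (size B - d)" by simp
  then show "v \<in># mspan B \<Longrightarrow> count (mspan B) v = CARD('q) ^ (size B - d)"
    by (simp add: count_mspan_const)
qed

lemma multispace_if_uniform:
  fixes W :: "('q::{field,finite} ^ 'n::finite) multiset"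
  assumes sub: "vec.subspace (set_mset W)" and t: "\<And>v. v \<in># W \<Longrightarrow> count W v = CARD('q) ^ t"
  shows "multispace W"
proof -
  obtain S where S: "S \<subseteq> set_mset W" "vec.independent S" "set_mset W \<subseteq> vec.span S"
    "card S = vec.dim (set_mset W)"
    using vec.basis_exists by blast
  then have span: "vec.span S = set_mset W"
    using sub by (simp add: vec.span_subspace)
  \<comment> \<open>Each copy of 0 leaves the span unchanged but has a free coefficient, so it
    multiplies every multiplicity by q; the basis \<open>S\<close> alone would give multiplicity
    1.\<close>
  define B where "B = mset_set S + replicate_mset t 0"
  have "set_mset B = S \<union> (if t = 0 then {} else {0})"
    by (auto simp: B_def)
  then have spanB: "vec.span (set_mset B) = set_mset W"
    using span by (simp add: vec.span_insert_0)
  have "size B - vec.dim (vec.span (set_mset B)) = t"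
    unfolding spanB using S(4) by (simp add: B_def)
  with count_mspan_eq(2)[of _ B] have cnt: "v \<in># mspan B \<Longrightarrow> count (mspan B) v = CARD('q) ^ t" for v
    by simp
  have "W = mspan B"
  proof (rule multiset_eqI)
    fix v
    \<comment> \<open>The underlying sets agree: on them both counts are q^t, elsewhere both are
      0.\<close>
    show "count W v = count (mspan B) v"
      using t[of v] cnt[of v] set_mset_mspan[of B] spanB
      by (cases "v \<in># W") (simp_all, metis not_in_iff)
  qed
  then show ?thesis unfolding multispace_def by blast
qed

theorem proposition2p3:
  fixes W :: "('q::{field,finite} ^ 'n::finite) multiset"
  shows "(multispace W \<longleftrightarrow>
           vec.subspace (set_mset W) \<and> (\<exists>t::nat. \<forall>v\<in>#W. count W v = CARD('q) ^ t)) \<and>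
         (multispace W \<longrightarrow>
           (\<forall>t::nat. (\<forall>v\<in>#W. count W v = CARD('q) ^ t) \<longrightarrow>
             int t = int (mrank W) - int (mdim W)))"
proof (intro conjI iffI impI allI)
  assume "multispace W"
  then obtain B where W: "W = mspan B" unfolding multispace_def by blast
  show "vec.subspace (set_mset W)"
    by (simp add: W set_mset_mspan vec.subspace_span)
  show "\<exists>t. \<forall>v\<in>#W. count W v = CARD('q) ^ t"
    using count_mspan_eq(2)[of _ B] unfolding W by blast
next
  assume "vec.subspace (set_mset W) \<and> (\<exists>t. \<forall>v\<in>#W. count W v = CARD('q) ^ t)"
  then show "multispace W" using multispace_if_uniform by blast
next
  fix t
  assume "multispace W" and t: "\<forall>v\<in>#W. count W v = CARD('q) ^ t"
  then obtain B where W: "W = mspan B" unfolding multispace_def by blast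
  \<comment> \<open>A multispace is never empty, so the condition on \<open>t\<close> is not
    vacuous; evaluating it at 0 determines \<open>t\<close>.\<close>
  have "0 \<in># mspan B" by (simp add: set_mset_mspan vec.span_zero)
  with t count_mspan_eq(2)[of 0 B]
  have "CARD('q) ^ t = CARD('q) ^ (size B - vec.dim (vec.span (set_mset B)))"
    unfolding W by simp
  then have "t = size B - vec.dim (vec.span (set_mset B))"
    using one_less_CARD_field[where 'q = 'q] by simp
  then show "int t = int (mrank W) - int (mdim W)"
    unfolding W mrank_mspan mdim_mspan using count_mspan_eq(1)[of B] by simp
qed

end
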